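(* Let $\lambda_1,\dots,\lambda_N$ be positive integers, let $\gamma_{i,k}$ ($1\le i\le N$, $1\le k\le\lambda_i$) be fixed, and let $h\to\infty$, with $q_1,\dots,q_N$ depending on $h$, in such a way that $$r_i=h^{\lambda_i+\lambda_{i+1}}\,q_{i+1}/q_i,\qquad i=1,\dots,N-1,$$ are fixed. Then $$W^q(u)\prod_{1\le i<j\le N}(q_i-q_j)^{-1}\ \longrightarrow\ \det M(u),$$ where $W^q(u)=\det\Big(q_i^{N-j}\prod_{k=1}^{\lambda_i}\big(u-\gamma_{i,k}+h(i-j)\big)\Big)_{i,j=1}^N$ and $M(u)$ is the $N\times N$ tridiagonal matrix with $M_{i,j}(u)=0$ for $|i-j|>1$, $M_{i,i}(u)=\prod_{k=1}^{\lambda_i}(u-\gamma_{i,k})$ for $i=1,\dots,N$, and $M_{i,i+1}(u)=(-1)^{\lambda_i}$, $M_{i+1,i}(u)=r_i$ for $i=1,\dots,N-1$.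
   Context: $u$ is a formal variable; the limit is of polynomials in $u$ (coefficientwise), with the $\gamma_{i,k}$ treated as fixed numbers or formal variables. The parameters $q_1,\dots,q_N$ are nonzero and distinct. *)

theory Defs
  imports Complex_Main "HOL-Computational_Algebra.Polynomial" "Jordan_Normal_Form.Determinant"
begin

text \<open>
  All families \<open>lam\<close> (the integers \<open>\<lambda>\<^sub>i\<close>), \<open>\<gamma>\<close>, \<open>q\<close>, \<open>r\<close> and all matrix entries below
  are indexed from 1, as in the mathematical text, whereas the matrices of
  \<^theory>\<open>Jordan_Normal_Form.Matrix\<close> are indexed from 0.
  The formal variable \<open>u\<close> is the variable of the type \<^typ>\<open>complex poly\<close>.
\<close>

definition mat_from_1 :: "nat \<Rightarrow> (nat \<Rightarrow> nat \<Rightarrow> 'a) \<Rightarrow> 'a mat" where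
  "mat_from_1 N a = mat N N (\<lambda>(i, j). a (i + 1) (j + 1))"

definition Wq :: "nat \<Rightarrow> (nat \<Rightarrow> nat) \<Rightarrow> (nat \<Rightarrow> nat \<Rightarrow> complex) \<Rightarrow> (nat \<Rightarrow> complex) \<Rightarrow> complex
    \<Rightarrow> complex poly" where
  "Wq N lam \<gamma> q h = det (mat_from_1 N (\<lambda>i j.
     smult (q i ^ (N - j)) (\<Prod>k = 1..lam i. [: - \<gamma> i k + h * (of_nat i - of_nat j), 1 :])))"

definition Mmat :: "nat \<Rightarrow> (nat \<Rightarrow> nat) \<Rightarrow> (nat \<Rightarrow> nat \<Rightarrow> complex) \<Rightarrow> (nat \<Rightarrow> complex)
    \<Rightarrow> complex poly mat" where
  "Mmat N lam \<gamma> r = mat_from_1 N (\<lambda>i j.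
     if j = i then \<Prod>k = 1..lam i. [: - \<gamma> i k, 1 :]
     else if j = i + 1 then (-1) ^ lam i
     else if i = j + 1 then [: r j :]
     else 0)"

end

theory Submission imports Defs begin

text \<open>
  The matrix of \<open>W\<^sup>q(u)\<close> does not converge, but it does after its rows and columns are rescaled.
  Put \<open>c\<^sub>j = \<Prod>k<j. q\<^sub>k / h ^ \<lambda>\<^sub>k\<close>, multiply column \<open>j\<close> by \<open>c\<^sub>j\<close> and divide row \<open>i\<close> by
  \<open>q\<^sub>i ^ (N - i) * c\<^sub>i\<close>. This divides the determinant by \<open>\<Prod>i. q\<^sub>i ^ (N - i)\<close>. Since
  \<open>\<Prod>k. (u - \<gamma>\<^sub>i\<^sub>k + h (i - j))\<close> is asymptotic to \<open>(i - j) ^ \<lambda>\<^sub>i * h ^ \<lambda>\<^sub>i\<close> for \<open>i \<noteq> j\<close>, the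
  rescaled entry at \<open>(i, j)\<close> behaves like \<open>(i - j) ^ \<lambda>\<^sub>i\<close> times a scalar, and this scalar equals
    \<^item> \<open>\<Prod>i<k<j. (q\<^sub>k / q\<^sub>i) / h ^ \<lambda>\<^sub>k\<close> above the diagonal (\<open>scalar_upper\<close>),
    \<^item> \<open>r\<^sub>i\<^sub>-\<^sub>1 * (\<Prod>j\<le>k<i-1. q\<^sub>i * h ^ \<lambda>\<^sub>k / q\<^sub>k)\<close> below it (\<open>scalar_lower\<close>).

  Fixing the \<open>r\<^sub>i\<close> makes \<open>q\<^sub>i\<close> so small compared with \<open>q\<^sub>k\<close>, \<open>k < i\<close>, that even
  \<open>q\<^sub>i * h ^ \<lambda>\<^sub>k / q\<^sub>k\<close> tends to \<open>0\<close> (\<open>q_ratio_power_tendsto_0\<close>). So both products tend to \<open>0\<close>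
  unless they are empty, and they are empty precisely next to the diagonal. The diagonal entries are
  those of \<open>M(u)\<close> from the start. Hence the rescaled matrix tends entrywise to \<open>M(u)\<close>
  (\<open>scaled_tendsto\<close>), and its determinant, being a polynomial in the entries, tends to \<open>det M(u)\<close>.

  Finally \<open>\<Prod>i<j. (q\<^sub>i - q\<^sub>j)\<close> is \<open>\<Prod>i. q\<^sub>i ^ (N - i)\<close> times \<open>\<Prod>i<j. (1 - q\<^sub>j / q\<^sub>i)\<close>, and the latter
  tends to \<open>1\<close>.
\<close>

section \<open>Coefficientwise convergence of polynomials\<close>

definition coeff_tendsto :: "('a \<Rightarrow> complex poly) \<Rightarrow> complex poly \<Rightarrow> 'a filter \<Rightarrow> bool" where
  "coeff_tendsto f p F \<longleftrightarrow> (\<forall>m. ((\<lambda>h. coeff (f h) m) \<longlongrightarrow> coeff p m) F)"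

lemma coeff_tendsto_const: "coeff_tendsto (\<lambda>_. p) p F"
  by (simp add: coeff_tendsto_def)

lemma coeff_tendsto_linear:
  assumes "(a \<longlongrightarrow> a') F" and "(b \<longlongrightarrow> b') F"
  shows "coeff_tendsto (\<lambda>h. [: a h, b h :]) [: a', b' :] F"
  unfolding coeff_tendsto_def
proof
  fix m
  consider "m = 0" | "m = 1" | m' where "m = Suc (Suc m')"
    by (metis One_nat_def old.nat.exhaust)
  thus "((\<lambda>h. coeff [: a h, b h :] m) \<longlongrightarrow> coeff [: a', b' :] m) F"
    using assms by cases simp_all
qed

lemma coeff_tendsto_cong:
  assumes "\<forall>\<^sub>F h in F. f h = g h" and "coeff_tendsto g p F"
  shows "coeff_tendsto f p F"
  unfolding coeff_tendsto_def
proof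
  fix m
  show "((\<lambda>h. coeff (f h) m) \<longlongrightarrow> coeff p m) F"
    by (rule Lim_transform_eventually[of "\<lambda>h. coeff (g h) m"])
      (use assms in \<open>auto simp: coeff_tendsto_def elim: eventually_mono\<close>)
qed

lemma coeff_tendsto_smult:
  assumes "(c \<longlongrightarrow> a) F" and "coeff_tendsto f p F"
  shows "coeff_tendsto (\<lambda>h. smult (c h) (f h)) (smult a p) F"
  using assms by (auto simp: coeff_tendsto_def intro!: tendsto_mult)

lemma coeff_tendsto_mult:
  assumes "coeff_tendsto f p F" and "coeff_tendsto g s F"
  shows "coeff_tendsto (\<lambda>h. f h * g h) (p * s) F"
  using assms by (auto simp: coeff_tendsto_def coeff_mult intro!: tendsto_sum tendsto_mult)

lemma coeff_tendsto_sum: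
  assumes "\<And>x. x \<in> A \<Longrightarrow> coeff_tendsto (f x) (p x) F"
  shows "coeff_tendsto (\<lambda>h. \<Sum>x\<in>A. f x h) (\<Sum>x\<in>A. p x) F"
  using assms by (auto simp: coeff_tendsto_def coeff_sum intro!: tendsto_sum)

lemma coeff_tendsto_prod:
  assumes "\<And>x. x \<in> A \<Longrightarrow> coeff_tendsto (f x) (p x) F"
  shows "coeff_tendsto (\<lambda>h. \<Prod>x\<in>A. f x h) (\<Prod>x\<in>A. p x) F"
  using assms
  by (induction A rule: infinite_finite_induct)
    (auto intro: coeff_tendsto_mult coeff_tendsto_const)

lemma coeff_tendsto_det:
  assumes "\<And>i j. i \<in> {1..N} \<Longrightarrow> j \<in> {1..N} \<Longrightarrow> coeff_tendsto (f i j) (p i j) F"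
  shows "coeff_tendsto (\<lambda>h. det (mat_from_1 N (\<lambda>i j. f i j h))) (det (mat_from_1 N p)) F"
proof -
  have "coeff_tendsto (\<lambda>h. \<Sum>\<sigma> | \<sigma> permutes {0..<N}.
            signof \<sigma> * (\<Prod>i = 0..<N. mat_from_1 N (\<lambda>i j. f i j h) $$ (i, \<sigma> i)))
          (\<Sum>\<sigma> | \<sigma> permutes {0..<N}.
            signof \<sigma> * (\<Prod>i = 0..<N. mat_from_1 N p $$ (i, \<sigma> i))) F"
  proof (intro coeff_tendsto_sum coeff_tendsto_mult coeff_tendsto_const coeff_tendsto_prod)
    fix \<sigma> i assume "\<sigma> \<in> {\<sigma>. \<sigma> permutes {0..<N}}" and "i \<in> {0..<N}"
    hence "i < N" "\<sigma> i < N"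
      using permutes_in_image[of \<sigma> "{0..<N}" i] by auto
    thus "coeff_tendsto (\<lambda>h. mat_from_1 N (\<lambda>i j. f i j h) $$ (i, \<sigma> i))
            (mat_from_1 N p $$ (i, \<sigma> i)) F"
      using assms[of "i + 1" "\<sigma> i + 1"] by (simp add: mat_from_1_def)
  qed
  thus ?thesis by (simp add: det_def mat_from_1_def)
qed

lemma carrier_mat_from_1 [simp]: "mat_from_1 N f \<in> carrier_mat N N"
  by (simp add: mat_from_1_def)

section \<open>Scaling of determinants and of Vandermonde products\<close>

text \<open>
  Each term of the Leibniz expansion takes exactly one entry from every row and every column, so it
  picks up all the factors \<open>a i\<close> and all the factors \<open>b j\<close> once.
\<close>
lemma det_mat_from_1_scale:
  fixes f :: "nat \<Rightarrow> nat \<Rightarrow> complex poly"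
  shows "det (mat_from_1 N (\<lambda>i j. smult (a i * b j) (f i j))) =
           smult (\<Prod>i = 1..N. a i * b i) (det (mat_from_1 N f))"
proof -
  have "(\<Prod>i = 0..<N. mat_from_1 N (\<lambda>i j. smult (a i * b j) (f i j)) $$ (i, \<sigma> i)) =
          smult (\<Prod>i = 1..N. a i * b i) (\<Prod>i = 0..<N. mat_from_1 N f $$ (i, \<sigma> i))"
    if \<sigma>: "\<sigma> permutes {0..<N}" for \<sigma>
  proof -
    have lt: "\<sigma> i < N" if "i < N" for i
      using permutes_in_image[OF \<sigma>, of i] that by auto
    have "(\<Prod>i = 0..<N. mat_from_1 N (\<lambda>i j. smult (a i * b j) (f i j)) $$ (i, \<sigma> i)) =
            (\<Prod>i = 0..<N. smult (a (i + 1) * b (\<sigma> i + 1)) (mat_from_1 N f $$ (i, \<sigma> i)))"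
      by (rule prod.cong) (auto simp: mat_from_1_def lt)
    also have "\<dots> = smult (\<Prod>i = 0..<N. a (i + 1) * b (\<sigma> i + 1))
                       (\<Prod>i = 0..<N. mat_from_1 N f $$ (i, \<sigma> i))"
      by (simp add: prod_smult)
    also have "(\<Prod>i = 0..<N. a (i + 1) * b (\<sigma> i + 1)) =
                 (\<Prod>i = 0..<N. a (i + 1)) * (\<Prod>i = 0..<N. b (i + 1))"
      using prod.permute[OF \<sigma>, of "\<lambda>i. b (i + 1)"] by (simp add: prod.distrib o_def)
    also have "\<dots> = (\<Prod>i = 1..N. a i * b i)"
      by (simp add: prod.distrib prod.atLeast_Suc_atMost_Suc_shift
            prod.shift_bounds_Suc_ivl[symmetric] atLeastLessThanSuc_atLeastAtMost)
    finally show ?thesis .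
  qed
  note prod_scale = this
  let ?c = "\<Prod>i = 1..N. a i * b i"
  have "det (mat_from_1 N (\<lambda>i j. smult (a i * b j) (f i j))) =
          (\<Sum>\<sigma> | \<sigma> permutes {0..<N}.
            signof \<sigma> * smult ?c (\<Prod>i = 0..<N. mat_from_1 N f $$ (i, \<sigma> i)))"
    by (subst det_def'[of _ N]) (auto simp: prod_scale intro!: sum.cong)
  also have "\<dots> = [:?c:] * (\<Sum>\<sigma> | \<sigma> permutes {0..<N}.
                       signof \<sigma> * (\<Prod>i = 0..<N. mat_from_1 N f $$ (i, \<sigma> i)))"
    by (simp add: sum_distrib_left)
  also have "\<dots> = smult ?c (det (mat_from_1 N f))"
    by (subst det_def'[of "mat_from_1 N f" N]) simp_all
  finally show ?thesis .
qed

text \<open>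
  Pulling \<open>q i\<close> out of each \<open>q i - q j\<close> extracts it once for each of the
  \<open>N - i\<close> indices \<open>j > i\<close>.
\<close>
lemma inverse_vandermonde_factor:
  fixes q :: "nat \<Rightarrow> complex"
  assumes q: "\<forall>i\<in>{1..N}. q i \<noteq> 0"
  shows "(\<Prod>(i, j)\<in>{(i, j). 1 \<le> i \<and> i < j \<and> j \<le> N}. inverse (q i - q j)) =
           (\<Prod>(i, j)\<in>{(i, j). 1 \<le> i \<and> i < j \<and> j \<le> N}. inverse (1 - q j / q i)) *
           (\<Prod>i = 1..N. inverse (q i ^ (N - i)))"
proof -
  let ?T = "{(i, j). 1 \<le> i \<and> i < j \<and> j \<le> N}"
  have T: "?T = Sigma {1..N} (\<lambda>i. {i<..N})" by auto
  have "(\<Prod>(i, j)\<in>?T. inverse (q i - q j)) =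
          (\<Prod>(i, j)\<in>?T. inverse (1 - q j / q i) * inverse (q i))"
  proof (rule prod.cong)
    fix x assume "x \<in> ?T"
    then obtain i j where x: "x = (i, j)" and i: "i \<in> {1..N}" by auto
    have "q i - q j = (1 - q j / q i) * q i"
      using q i by (auto simp: field_simps)
    thus "(case x of (i, j) \<Rightarrow> inverse (q i - q j)) =
            (case x of (i, j) \<Rightarrow> inverse (1 - q j / q i) * inverse (q i))"
      by (simp add: x)
  qed simp
  also have "\<dots> = (\<Prod>(i, j)\<in>?T. inverse (1 - q j / q i)) * (\<Prod>(i, j)\<in>?T. inverse (q i))"
    by (simp add: prod.distrib case_prod_unfold)
  also have "(\<Prod>(i, j)\<in>?T. inverse (q i)) = (\<Prod>i = 1..N. inverse (q i ^ (N - i)))"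
    unfolding T by (subst prod.Sigma[symmetric]) (auto simp: power_inverse)
  finally show ?thesis .
qed

section \<open>Asymptotics of the ratios of the parameters\<close>

locale scaling_regime =
  fixes N :: nat
    and lam :: "nat \<Rightarrow> nat"
    and \<gamma> :: "nat \<Rightarrow> nat \<Rightarrow> complex"
    and q :: "nat \<Rightarrow> complex \<Rightarrow> complex"
    and r :: "nat \<Rightarrow> complex"
    and F :: "complex filter"
  assumes lam_pos: "i \<in> {1..N} \<Longrightarrow> 0 < lam i"
    and F_le: "F \<le> at_infinity"
    and q_nonzero: "\<forall>\<^sub>F h in F. \<forall>i\<in>{1..N}. q i h \<noteq> 0"
    and r_eq: "\<forall>\<^sub>F h in F. \<forall>i\<in>{1..<N}. r i = h ^ (lam i + lam (i + 1)) * (q (i + 1) h / q i h)"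
begin

lemma h_nonzero: "\<forall>\<^sub>F h in F. h \<noteq> 0"
proof -
  have "\<forall>\<^sub>F h in at_infinity. (h::complex) \<noteq> 0"
    by (auto simp: eventually_at_infinity intro!: exI[of _ 1])
  thus ?thesis using F_le by (rule filter_leD[rotated])
qed

lemma inverse_power_tendsto_0:
  assumes "0 < n"
  shows "((\<lambda>h::complex. inverse (h ^ n)) \<longlongrightarrow> 0) F"
proof -
  have "((\<lambda>h::complex. inverse h ^ n) \<longlongrightarrow> 0 ^ n) F"
    by (intro tendsto_power tendsto_mono[OF F_le tendsto_inverse_0])
  thus ?thesis using assms by (simp add: power_inverse zero_power)
qed

lemma consecutive_ratio:
  assumes "i \<in> {1..<N}"
  shows "\<forall>\<^sub>F h in F. q (i + 1) h / q i h = r i * inverse (h ^ (lam i + lam (i + 1)))"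
  using r_eq h_nonzero
  by eventually_elim (use assms in \<open>auto simp: field_simps\<close>)

text \<open>
  For neighbours, \<open>q (k + 1) h * h ^ lam k / q k h = r k / h ^ lam (k + 1)\<close>, which tends to \<open>0\<close>
  because \<open>lam (k + 1)\<close> is positive. Each further step multiplies by a ratio
  \<open>q (n + 1) h / q n h\<close>, which tends to \<open>0\<close> as well.
\<close>
lemma q_ratio_power_tendsto_0:
  assumes "1 \<le> k" "k < i" "i \<le> N"
  shows "((\<lambda>h. q i h * h ^ lam k / q k h) \<longlongrightarrow> 0) F"
proof -
  have "Suc k \<le> i" using assms by simp
  thus ?thesis using \<open>i \<le> N\<close>
  proof (induction i rule: dec_induct)
    case base
    have "((\<lambda>h. r k * inverse (h ^ lam (k + 1))) \<longlongrightarrow> r k * 0) F"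
      by (intro tendsto_mult tendsto_const inverse_power_tendsto_0 lam_pos) (use base in auto)
    moreover have "\<forall>\<^sub>F h in F. r k * inverse (h ^ lam (k + 1)) = q (Suc k) h * h ^ lam k / q k h"
    proof -
      have k: "k \<in> {1..<N}" using assms(1) base by auto
      show ?thesis using consecutive_ratio[OF k] h_nonzero
      proof eventually_elim
        case (elim h)
        have "q (Suc k) h * h ^ lam k / q k h = (q (k + 1) h / q k h) * h ^ lam k" by simp
        also have "\<dots> = r k * inverse (h ^ lam (k + 1))"
          using elim(2) by (subst elim(1)) (simp add: power_add)
        finally show ?case by simp
      qed
    qed
    ultimately show ?case
      by (auto intro: Lim_transform_eventually)
  next
    case (step n)
    have "((\<lambda>h. (r n * inverse (h ^ (lam n + lam (n + 1)))) * (q n h * h ^ lam k / q k h)) \<longlongrightarrow> (r n * 0) * 0) F"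
      by (intro tendsto_mult tendsto_const inverse_power_tendsto_0 step.IH)
        (use step assms(1) lam_pos[of n] in auto)
    moreover have "\<forall>\<^sub>F h in F. (r n * inverse (h ^ (lam n + lam (n + 1)))) * (q n h * h ^ lam k / q k h) =
                     q (Suc n) h * h ^ lam k / q k h"
    proof -
      have n: "n \<in> {1..<N}" using step assms(1) by auto
      show ?thesis using consecutive_ratio[OF n] q_nonzero
      proof eventually_elim
        case (elim h)
        have "q n h \<noteq> 0" using elim(2) n by auto
        thus ?case by (subst elim(1)[symmetric]) simp
      qed
    qed
    ultimately show ?case
      by (auto intro: Lim_transform_eventually)
  qed
qed

lemma q_ratio_tendsto_0:
  assumes "1 \<le> k" "k < i" "i \<le> N"
  shows "((\<lambda>h. q i h / q k h) \<longlongrightarrow> 0) F"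
proof (rule Lim_transform_eventually)
  have "((\<lambda>h. (q i h * h ^ lam k / q k h) * inverse (h ^ lam k)) \<longlongrightarrow> 0 * 0) F"
    by (intro tendsto_mult q_ratio_power_tendsto_0 inverse_power_tendsto_0 lam_pos)
      (use assms in auto)
  thus "((\<lambda>h. (q i h * h ^ lam k / q k h) * inverse (h ^ lam k)) \<longlongrightarrow> 0) F" by simp
  show "\<forall>\<^sub>F h in F. (q i h * h ^ lam k / q k h) * inverse (h ^ lam k) = q i h / q k h"
    using h_nonzero by eventually_elim simp
qed

section \<open>Entrywise convergence of the rescaled matrix\<close>

abbreviation entry_poly :: "nat \<Rightarrow> nat \<Rightarrow> complex \<Rightarrow> complex poly" where
  "entry_poly i j h \<equiv> (\<Prod>k = 1..lam i. [: - \<gamma> i k + h * (of_nat i - of_nat j), 1 :])"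

text \<open>
  The limit dictates these factors: the ratio \<open>col_factor h (i + 1) / col_factor h i\<close> is what
  the entry at \<open>(i, i + 1)\<close> needs in order to have a finite nonzero limit, and \<open>row_factor\<close> then
  normalizes the diagonal.
\<close>
definition col_factor :: "complex \<Rightarrow> nat \<Rightarrow> complex" where
  "col_factor h j = (\<Prod>k = 1..<j. q k h / h ^ lam k)"

definition row_factor :: "complex \<Rightarrow> nat \<Rightarrow> complex" where
  "row_factor h i = inverse (q i h ^ (N - i) * col_factor h i)"

abbreviation scaled :: "nat \<Rightarrow> nat \<Rightarrow> complex \<Rightarrow> complex poly" where
  "scaled i j h \<equiv> smult (row_factor h i * col_factor h j) (smult (q i h ^ (N - j)) (entry_poly i j h))"

text \<open>
  Dividing each of the \<open>lam i\<close> linear factors by \<open>h\<close> leaves \<open>i - j\<close> in the limit, because both \<open>u\<close>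
  and \<open>\<gamma> i k\<close> are then multiplied by \<open>1 / h\<close>.
\<close>
lemma entry_poly_normalized_tendsto:
  "coeff_tendsto (\<lambda>h. smult (inverse (h ^ lam i)) (entry_poly i j h)) [:(of_nat i - of_nat j) ^ lam i:] F"
proof (rule coeff_tendsto_cong)
  show "\<forall>\<^sub>F h in F. smult (inverse (h ^ lam i)) (entry_poly i j h) =
          (\<Prod>k = 1..lam i. [: - \<gamma> i k * inverse h + (of_nat i - of_nat j), inverse h :])"
    using h_nonzero
  proof eventually_elim
    case (elim h)
    have "smult (inverse (h ^ lam i)) (entry_poly i j h) =
            (\<Prod>k = 1..lam i. smult (inverse h) [: - \<gamma> i k + h * (of_nat i - of_nat j), 1 :])"
      by (simp only: prod_smult) (simp add: power_inverse)
    also have "\<dots> = (\<Prod>k = 1..lam i. [: - \<gamma> i k * inverse h + (of_nat i - of_nat j), inverse h :])"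
      using elim by (intro prod.cong) (auto simp: field_simps)
    finally show ?case .
  qed
  have "coeff_tendsto
          (\<lambda>h. \<Prod>k = 1..lam i. [: - \<gamma> i k * inverse h + (of_nat i - of_nat j), inverse h :])
          (\<Prod>k = 1..lam i. [: - \<gamma> i k * 0 + (of_nat i - of_nat j), 0 :]) F"
  proof (rule coeff_tendsto_prod)
    fix k
    have "((\<lambda>h::complex. inverse h) \<longlongrightarrow> 0) F"
      by (rule tendsto_mono[OF F_le tendsto_inverse_0])
    thus "coeff_tendsto (\<lambda>h. [: - \<gamma> i k * inverse h + (of_nat i - of_nat j), inverse h :])
            [: - \<gamma> i k * 0 + (of_nat i - of_nat j), 0 :] F"
      by (intro coeff_tendsto_linear tendsto_intros)
  qed
  thus "coeff_tendsto
          (\<lambda>h. \<Prod>k = 1..lam i. [: - \<gamma> i k * inverse h + (of_nat i - of_nat j), inverse h :])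
          [:(of_nat i - of_nat j) ^ lam i:] F"
    by (simp add: poly_const_pow)
qed

lemma col_factor_split:
  assumes "1 \<le> i" "i \<le> j"
  shows "col_factor h j = col_factor h i * (\<Prod>k = i..<j. q k h / h ^ lam k)"
  using assms by (simp add: col_factor_def prod.atLeastLessThan_concat)

lemma col_factor_nonzero:
  assumes "h \<noteq> 0" "\<forall>i\<in>{1..N}. q i h \<noteq> 0" "j \<le> N"
  shows "col_factor h j \<noteq> 0"
  using assms by (auto simp: col_factor_def)

text \<open>
  The factor \<open>q i h / h ^ lam i\<close> of \<open>col_factor h j\<close> absorbs the growth \<open>h ^ lam i\<close> of the entry;
  the \<open>j - i - 1\<close> factors \<open>1 / q i h\<close> that are left turn each remaining \<open>q k h\<close> into a ratio.
\<close>
lemma scalar_upper: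
  assumes h: "h \<noteq> 0" and q: "\<forall>i\<in>{1..N}. q i h \<noteq> 0" and ij: "1 \<le> i" "i < j" "j \<le> N"
  shows "row_factor h i * col_factor h j * q i h ^ (N - j) * h ^ lam i =
           (\<Prod>k = Suc i..<j. q k h / q i h * inverse (h ^ lam k))"
proof -
  have qi: "q i h \<noteq> 0" using q ij by auto
  have ci: "col_factor h i \<noteq> 0" using col_factor_nonzero[OF h q] ij by auto
  have "col_factor h j = col_factor h i * (q i h / h ^ lam i * (\<Prod>k = Suc i..<j. q k h / h ^ lam k))"
    using col_factor_split[of i j h] ij by (simp add: prod.atLeast_Suc_lessThan)
  moreover have "q i h ^ (N - i) = q i h ^ (N - j) * (q i h * q i h ^ (j - Suc i))"
  proof -
    have "N - i = (N - j) + Suc (j - Suc i)" using ij by simp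
    thus ?thesis by (simp only: power_add power_Suc)
  qed
  moreover have "(\<Prod>k = Suc i..<j. q k h / q i h * inverse (h ^ lam k)) =
                   inverse (q i h ^ (j - Suc i)) * (\<Prod>k = Suc i..<j. q k h / h ^ lam k)"
    by (simp add: divide_inverse prod.distrib power_inverse)
  ultimately show ?thesis
    using qi ci h by (simp add: row_factor_def field_simps)
qed

text \<open>
  Below the diagonal the column factors enter inverted. The one with index \<open>i\<close>, together with the
  growth \<open>h ^ lam (Suc i)\<close> of the entry and one power of \<open>q (Suc i) h\<close>, gives exactly the quantity
  that is kept equal to \<open>r i\<close>. The row is indexed by \<open>Suc i\<close> to avoid subtraction.
\<close>
lemma scalar_lower:
  assumes h: "h \<noteq> 0" and q: "\<forall>i\<in>{1..N}. q i h \<noteq> 0" and ij: "1 \<le> j" "j \<le> i" "Suc i \<le> N"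
  shows "row_factor h (Suc i) * col_factor h j * q (Suc i) h ^ (N - j) * h ^ lam (Suc i) =
           h ^ (lam i + lam (Suc i)) * (q (Suc i) h / q i h) *
           (\<Prod>k = j..<i. q (Suc i) h * h ^ lam k / q k h)"
proof -
  define D where "D = (\<Prod>k = j..<i. q k h / h ^ lam k)"
  have qi: "q (Suc i) h \<noteq> 0" "q i h \<noteq> 0" using q ij by auto
  have cj: "col_factor h j \<noteq> 0" using col_factor_nonzero[OF h q] ij by auto
  have nz: "D \<noteq> 0" using q ij h by (auto simp: D_def)
  have col: "col_factor h (Suc i) = col_factor h j * (D * (q i h / h ^ lam i))"
    using col_factor_split[of j "Suc i" h] ij by (simp add: D_def)
  have pow: "q (Suc i) h ^ (N - j) =
               q (Suc i) h ^ (N - Suc i) * (q (Suc i) h * q (Suc i) h ^ (i - j))"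
  proof -
    have "N - j = (N - Suc i) + Suc (i - j)" using ij by simp
    thus ?thesis by (simp only: power_add power_Suc)
  qed
  have prod: "(\<Prod>k = j..<i. q (Suc i) h * h ^ lam k / q k h) = q (Suc i) h ^ (i - j) * inverse D"
  proof -
    have "(\<Prod>k = j..<i. q (Suc i) h * h ^ lam k / q k h) =
            (\<Prod>k = j..<i. q (Suc i) h * inverse (q k h / h ^ lam k))"
      by simp
    also have "\<dots> = q (Suc i) h ^ (i - j) * inverse D"
      unfolding prod.distrib prod_constant D_def by (simp add: prod_dividef)
    finally show ?thesis .
  qed
  show ?thesis
    unfolding row_factor_def col pow prod
    using qi cj h nz by (simp add: field_simps power_add)
qed

lemma scaled_tendsto_of_scalar:
  assumes "((\<lambda>h. row_factor h i * col_factor h j * q i h ^ (N - j) * h ^ lam i) \<longlongrightarrow> c) F"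
  shows "coeff_tendsto (scaled i j) (smult c [:(of_nat i - of_nat j) ^ lam i:]) F"
proof (rule coeff_tendsto_cong)
  show "\<forall>\<^sub>F h in F. scaled i j h = smult (row_factor h i * col_factor h j * q i h ^ (N - j) * h ^ lam i)
                                    (smult (inverse (h ^ lam i)) (entry_poly i j h))"
    using h_nonzero
  proof eventually_elim
    case (elim h)
    have "h ^ lam i * inverse (h ^ lam i) = 1" using elim by simp
    thus ?case by (simp only: smult_smult mult.assoc mult_1_right)
  qed
qed (intro coeff_tendsto_smult assms entry_poly_normalized_tendsto)

text \<open>
  The value \<open>1\<close> of the empty product is what makes the two neighbouring diagonals survive in the
  limit.
\<close>
lemma prod_tendsto_0:
  fixes f :: "nat \<Rightarrow> complex \<Rightarrow> complex"
  assumes "\<And>k. k \<in> {a..<b} \<Longrightarrow> (f k \<longlongrightarrow> 0) F"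
  shows "((\<lambda>h. \<Prod>k = a..<b. f k h) \<longlongrightarrow> (if a < b then 0 else 1)) F"
proof -
  have "((\<lambda>h. \<Prod>k = a..<b. f k h) \<longlongrightarrow> (\<Prod>k = a..<b. 0)) F"
    by (rule tendsto_prod) (use assms in auto)
  thus ?thesis by (auto simp: power_0_left split: if_splits)
qed

lemma scaled_tendsto:
  assumes ij: "i \<in> {1..N}" "j \<in> {1..N}"
  shows "coeff_tendsto (scaled i j)
           (if j = i then \<Prod>k = 1..lam i. [: - \<gamma> i k, 1 :]
            else if j = i + 1 then (-1) ^ lam i
            else if i = j + 1 then [: r j :]
            else 0) F"
proof -
  consider "j = i" | "i < j" | i' where "i = Suc i'" "j \<le> i'"
    by (metis Suc_le_D Suc_le_mono less_eq_Suc_le linorder_neqE_nat)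
  thus ?thesis
  proof cases
    case 1
    have "\<forall>\<^sub>F h in F. scaled i j h = (\<Prod>k = 1..lam i. [: - \<gamma> i k, 1 :])"
      using h_nonzero q_nonzero
    proof eventually_elim
      case (elim h)
      have "col_factor h i \<noteq> 0" "q i h \<noteq> 0" using col_factor_nonzero[OF elim, of i] elim(2) ij by auto
      hence "row_factor h i * col_factor h i * q i h ^ (N - i) = 1"
        by (simp add: row_factor_def field_simps)
      thus ?case using 1 by simp
    qed
    thus ?thesis using 1 by (auto intro: coeff_tendsto_cong coeff_tendsto_const)
  next
    case 2
    \<comment> \<open>the product over \<open>i < k < j\<close> is empty exactly on the superdiagonal\<close>
    define c :: complex where "c = (if Suc i < j then 0 else 1)"
    have "((\<lambda>h. \<Prod>k = Suc i..<j. q k h / q i h * inverse (h ^ lam k)) \<longlongrightarrow> c) F"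
      unfolding c_def
    proof (rule prod_tendsto_0)
      fix k assume k: "k \<in> {Suc i..<j}"
      have "((\<lambda>h. q k h / q i h * inverse (h ^ lam k)) \<longlongrightarrow> 0 * 0) F"
        by (intro tendsto_mult q_ratio_tendsto_0 inverse_power_tendsto_0 lam_pos)
          (use k ij in auto)
      thus "((\<lambda>h. q k h / q i h * inverse (h ^ lam k)) \<longlongrightarrow> 0) F" by simp
    qed
    moreover have "\<forall>\<^sub>F h in F. (\<Prod>k = Suc i..<j. q k h / q i h * inverse (h ^ lam k)) =
                     row_factor h i * col_factor h j * q i h ^ (N - j) * h ^ lam i"
      using h_nonzero q_nonzero
      by eventually_elim (rule scalar_upper[symmetric], use ij 2 in auto)
    ultimately have "((\<lambda>h. row_factor h i * col_factor h j * q i h ^ (N - j) * h ^ lam i) \<longlongrightarrow> c) F"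
      by (rule Lim_transform_eventually)
    hence "coeff_tendsto (scaled i j) (smult c [:(of_nat i - of_nat j) ^ lam i:]) F"
      by (rule scaled_tendsto_of_scalar)
    moreover have "[:(-1) ^ lam i:] = (-1 :: complex poly) ^ lam i"
      by (simp add: poly_const_pow[symmetric] one_pCons)
    ultimately show ?thesis using 2 by (auto simp: c_def)
  next
    case 3
    \<comment> \<open>the product over \<open>j \<le> k < i'\<close> is empty exactly on the subdiagonal, \<open>j = i'\<close>\<close>
    define c :: complex where "c = r i' * (if j < i' then 0 else 1)"
    have i': "i' \<in> {1..<N}" using 3 ij by auto
    have "((\<lambda>h. r i' * (\<Prod>k = j..<i'. q (Suc i') h * h ^ lam k / q k h)) \<longlongrightarrow> c) F"
      unfolding c_def
      by (intro tendsto_mult tendsto_const prod_tendsto_0 q_ratio_power_tendsto_0)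
        (use ij 3 in auto)
    moreover have "\<forall>\<^sub>F h in F. r i' * (\<Prod>k = j..<i'. q (Suc i') h * h ^ lam k / q k h) =
                     row_factor h i * col_factor h j * q i h ^ (N - j) * h ^ lam i"
      using h_nonzero q_nonzero r_eq
    proof eventually_elim
      case (elim h)
      have "r i' = h ^ (lam i' + lam (Suc i')) * (q (Suc i') h / q i' h)"
        using elim(3) i' by auto
      thus ?case using scalar_lower[OF elim(1,2), of j i'] 3 ij by simp
    qed
    ultimately have "((\<lambda>h. row_factor h i * col_factor h j * q i h ^ (N - j) * h ^ lam i) \<longlongrightarrow> c) F"
      by (rule Lim_transform_eventually)
    hence "coeff_tendsto (scaled i j) (smult c [:(of_nat i - of_nat j) ^ lam i:]) F"
      by (rule scaled_tendsto_of_scalar)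
    thus ?thesis using 3 by (auto simp: c_def)
  qed
qed

section \<open>The limit of the determinant\<close>

text \<open>
  The column factors cancel against their inverses inside the row factors.
\<close>
lemma det_scaled:
  assumes h: "h \<noteq> 0" and q: "\<forall>i\<in>{1..N}. q i h \<noteq> 0"
  shows "det (mat_from_1 N (\<lambda>i j. scaled i j h)) =
           smult (\<Prod>i = 1..N. inverse (q i h ^ (N - i))) (Wq N lam \<gamma> (\<lambda>i. q i h) h)"
proof -
  have "row_factor h i * col_factor h i = inverse (q i h ^ (N - i))" if "i \<in> {1..N}" for i
    using col_factor_nonzero[OF h q, of i] that by (simp add: row_factor_def)
  thus ?thesis
    unfolding Wq_def det_mat_from_1_scale by simp
qed

lemma vandermonde_correction_tendsto_1:
  "((\<lambda>h. \<Prod>(i, j)\<in>{(i, j). 1 \<le> i \<and> i < j \<and> j \<le> N}. inverse (1 - q j h / q i h)) \<longlongrightarrow> 1) F"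
proof -
  let ?T = "{(i, j). 1 \<le> i \<and> i < j \<and> j \<le> N}"
  have "((\<lambda>h. \<Prod>x\<in>?T. inverse (1 - q (snd x) h / q (fst x) h)) \<longlongrightarrow>
          (\<Prod>x\<in>?T. inverse (1 - 0))) F"
    by (intro tendsto_prod tendsto_inverse tendsto_diff tendsto_const q_ratio_tendsto_0) auto
  thus ?thesis by (simp add: case_prod_unfold)
qed

theorem Wq_over_vandermonde_tendsto:
  "coeff_tendsto
     (\<lambda>h. smult (\<Prod>(i, j)\<in>{(i, j). 1 \<le> i \<and> i < j \<and> j \<le> N}. inverse (q i h - q j h))
            (Wq N lam \<gamma> (\<lambda>i. q i h) h))
     (det (Mmat N lam \<gamma> r)) F"
proof (rule coeff_tendsto_cong)
  let ?T = "{(i, j). 1 \<le> i \<and> i < j \<and> j \<le> N}"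
  show "\<forall>\<^sub>F h in F. smult (\<Prod>(i, j)\<in>?T. inverse (q i h - q j h)) (Wq N lam \<gamma> (\<lambda>i. q i h) h) =
          smult (\<Prod>(i, j)\<in>?T. inverse (1 - q j h / q i h))
            (det (mat_from_1 N (\<lambda>i j. scaled i j h)))"
    using h_nonzero q_nonzero
  proof eventually_elim
    case (elim h)
    show ?case
      unfolding det_scaled[OF elim] inverse_vandermonde_factor[of N "\<lambda>i. q i h", OF elim(2)]
      by (simp only: smult_smult)
  qed
  have "coeff_tendsto (\<lambda>h. det (mat_from_1 N (\<lambda>i j. scaled i j h))) (det (Mmat N lam \<gamma> r)) F"
    unfolding Mmat_def by (intro coeff_tendsto_det scaled_tendsto)
  from coeff_tendsto_smult[OF vandermonde_correction_tendsto_1 this]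
  show "coeff_tendsto (\<lambda>h. smult (\<Prod>(i, j)\<in>?T. inverse (1 - q j h / q i h))
            (det (mat_from_1 N (\<lambda>i j. scaled i j h)))) (det (Mmat N lam \<gamma> r)) F"
    by simp
qed

end

theorem theorem7p13:
  fixes N :: nat
    and lam :: "nat \<Rightarrow> nat"
    and \<gamma> :: "nat \<Rightarrow> nat \<Rightarrow> complex"
    and q :: "nat \<Rightarrow> complex \<Rightarrow> complex"
    and r :: "nat \<Rightarrow> complex"
    and F :: "complex filter"
  assumes "1 \<le> N"
    and "\<forall>i\<in>{1..N}. 0 < lam i"
    and "F \<le> at_infinity"
    and "\<forall>\<^sub>F h in F. \<forall>i\<in>{1..N}. q i h \<noteq> 0"
    and "\<forall>\<^sub>F h in F. inj_on (\<lambda>i. q i h) {1..N}"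
    and "\<forall>\<^sub>F h in F. \<forall>i\<in>{1..<N}. r i = h ^ (lam i + lam (i + 1)) * (q (i + 1) h / q i h)"
  shows "\<forall>m. ((\<lambda>h. coeff (smult (\<Prod>(i, j)\<in>{(i, j). 1 \<le> i \<and> i < j \<and> j \<le> N}. inverse (q i h - q j h))
                              (Wq N lam \<gamma> (\<lambda>i. q i h) h)) m)
              \<longlongrightarrow> coeff (det (Mmat N lam \<gamma> r)) m) F"
proof -
  interpret scaling_regime N lam \<gamma> q r F
    using assms by unfold_locales auto
  show ?thesis
    using Wq_over_vandermonde_tendsto unfolding coeff_tendsto_def .
qed

end
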